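(* Let $r(x)=\sum_{n\ge 0}x^{2^n-1}$. Let $(j_n)_{n\ge 0}$ be defined by $j_0=0$, $j_{2k}=j_k$, $j_{2k+1}=(-1)^k$, and $s_n=1+\sum_{0\le k\le n}j_k$. Then for every $n\ge 1$, $|H_{n+1}(1+xr(x))|=s_n-2$.
   Context: For a power series $f(x)=\sum_{i\ge 0}a_ix^i$ and $n\ge 1$, the Hankel determinant $H_n(f)$ is the determinant of the $n\times n$ matrix $(a_{i+j})_{0\le i,j\le n-1}$; $H_0(f)=1$. *)

theory Defs
  imports
    "HOL-Computational_Algebra.Formal_Power_Series"
    "Jordan_Normal_Form.Determinant"
begin

definition hankel_det :: "nat \<Rightarrow> 'a::comm_ring_1 fps \<Rightarrow> 'a" where
  "hankel_det n f = det (mat n n (\<lambda>(i, j). fps_nth f (i + j)))"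

lemma hankel_det_0: "hankel_det 0 f = 1"
  by (simp add: hankel_det_def)

(* The series converges in the metric topology of formal power series, see r_series_sums. *)
definition r_series :: "int fps" where
  "r_series = (\<Sum>n. fps_X ^ (2 ^ n - 1))"

lemma r_series_sums_aux:
  "(\<lambda>n. fps_X ^ (2 ^ n - 1)) sums
     (Abs_fps (\<lambda>m. if \<exists>n::nat. m = 2 ^ n - 1 then 1 else 0) :: int fps)"
  unfolding sums_def
proof (rule tendsto_fpsI)
  fix m :: nat
  let ?P = "\<lambda>N. fps_nth (\<Sum>n<N. fps_X ^ (2 ^ n - 1) :: int fps) m =
    fps_nth (Abs_fps (\<lambda>m. if \<exists>n::nat. m = 2 ^ n - 1 then 1 else 0)) m"
  have inj: "n = n'" if "(2::nat) ^ n - 1 = 2 ^ n' - 1" for n n' :: nat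
  proof -
    have "(1::nat) \<le> 2 ^ n" "(1::nat) \<le> 2 ^ n'" by simp_all
    with that have "(2::nat) ^ n = 2 ^ n'" by linarith
    then show ?thesis by simp
  qed
  have "?P N" if N: "m < N" for N
  proof -
    have coeff: "fps_nth (\<Sum>n<N. fps_X ^ (2 ^ n - 1) :: int fps) m =
        (\<Sum>n<N. if m = 2 ^ n - 1 then 1 else 0)"
      by (simp only: fps_sum_nth fps_X_power_nth)
    show ?thesis
    proof (cases "\<exists>n::nat. m = 2 ^ n - 1")
      case True
      then obtain n0 :: nat where n0: "m = 2 ^ n0 - 1" by blast
      have "n0 < 2 ^ n0" by (rule less_exp)
      then have "n0 < N" using n0 N by linarith
      moreover have "(m = 2 ^ n - 1) = (n = n0)" for n :: nat
        unfolding n0 using inj by blast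
      ultimately have "(\<Sum>n<N. if m = 2 ^ n - 1 then 1 else 0 :: int) = 1"
        by (simp only: sum.delta finite_lessThan lessThan_iff if_True)
      then show ?thesis by (simp only: coeff fps_nth_Abs_fps True if_True)
    next
      case False
      then have "(\<Sum>n<N. if m = 2 ^ n - 1 then 1 else 0 :: int) = 0"
        by (intro sum.neutral ballI if_not_P) blast
      then show ?thesis by (simp only: coeff fps_nth_Abs_fps False if_False)
    qed
  qed
  then show "eventually ?P sequentially"
    unfolding eventually_sequentially by (intro exI[of _ "Suc m"] allI impI) (simp only: Suc_le_eq)
qed

lemma r_series_nth:
  "fps_nth r_series m = (if \<exists>n::nat. m = 2 ^ n - 1 then 1 else 0)"
  unfolding r_series_def sums_unique[OF r_series_sums_aux, symmetric] by simp

lemma r_series_sums: "(\<lambda>n. fps_X ^ (2 ^ n - 1)) sums r_series"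
  unfolding r_series_def by (rule summable_sums[OF sums_summable[OF r_series_sums_aux]])

fun j_seq :: "nat \<Rightarrow> int" where
  "j_seq n = (if n = 0 then 0
              else if even n then j_seq (n div 2)
              else (- 1) ^ (n div 2))"

declare j_seq.simps [simp del]

lemma j_seq_recurrence:
  "j_seq 0 = 0"
  "j_seq (2 * k) = j_seq k"
  "j_seq (2 * k + 1) = (- 1) ^ k"
  by (subst j_seq.simps, simp)+

definition s_seq :: "nat \<Rightarrow> int" where
  "s_seq n = 1 + (\<Sum>k = 0..n. j_seq k)"

end

theory Submission
  imports Defs
begin

text \<open>
  Replace the constant term by an indeterminate value \<open>c\<close>. If \<open>h = 2 ^ k \<le> n < 2 * h\<close>, then row
  \<open>i\<close> of the Hankel matrix (rows and columns \<open>0, \<dots>, n\<close>) with \<open>h < i\<close> has a single entry, in column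
  \<open>2 * h - i\<close>, and row \<open>h\<close> has its entries in columns \<open>0\<close> and \<open>h\<close>; the same holds for columns.
  Eliminating the indices \<open>2 * h - n, \<dots>, n\<close> leaves the Hankel matrix of size \<open>2 * h - n\<close> with \<open>c\<close>
  replaced by \<open>c - 1\<close>, up to sign. On the other side, the partial sums of \<open>j\<close> satisfy
  \<open>S n = 1 + S (2 * h - 1 - n)\<close>, because \<open>S n = S (n div 2) + (n + 1) div 2 mod 2\<close>. Hence the
  determinant is \<open>c - S n\<close> up to sign.
\<close>

section \<open>Block elimination\<close>

lemma det_four_block_mat_absorb:
  fixes A :: "'a::idom mat"
  assumes A: "A \<in> carrier_mat p p" and B: "B \<in> carrier_mat p q"
    and C: "C \<in> carrier_mat q p" and D: "D \<in> carrier_mat q q"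
    and BD: "B * D = B"
  shows "det (four_block_mat A B C D) = det (A - B * C) * det D"
proof -
  let ?P = "four_block_mat (1\<^sub>m p) (- B) (0\<^sub>m q p) (1\<^sub>m q)"
  have nB: "- B \<in> carrier_mat p q" using B by simp
  have P: "?P \<in> carrier_mat (p + q) (p + q)" by simp
  have M: "four_block_mat A B C D \<in> carrier_mat (p + q) (p + q)"
    using A D by simp
  have "det ?P = 1"
    by (subst det_four_block_mat_lower_left_zero[of _ p _ q]) (use nB in simp_all)
  have "?P * four_block_mat A B C D =
      four_block_mat (1\<^sub>m p * A + - B * C) (1\<^sub>m p * B + - B * D)
        (0\<^sub>m q p * A + 1\<^sub>m q * C) (0\<^sub>m q p * B + 1\<^sub>m q * D)"
    by (rule mult_four_block_mat) (use A B C D in auto)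
  also have "1\<^sub>m p * A + - B * C = A - B * C"
    using A B C by (simp add: minus_add_uminus_mat[of _ p p] uminus_mult_left_mat)
  also have "1\<^sub>m p * B + - B * D = 0\<^sub>m p q"
    using B D BD by (simp add: uminus_mult_left_mat add_uminus_minus_mat[of _ p q])
  also have "0\<^sub>m q p * A + 1\<^sub>m q * C = C" using A C by simp
  also have "0\<^sub>m q p * B + 1\<^sub>m q * D = D" using B D by simp
  finally have "det ?P * det (four_block_mat A B C D) =
      det (four_block_mat (A - B * C) (0\<^sub>m p q) C D)"
    using det_mult[OF P M] by simp
  also have "\<dots> = det (A - B * C) * det D"
    by (rule det_four_block_mat_upper_right_zero) (use A B C D in auto)
  finally show ?thesis using \<open>det ?P = 1\<close> by simp
qed

section \<open>Coefficients of the series\<close>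

definition hseries :: "int \<Rightarrow> int fps" where
  "hseries c = fps_const c + fps_X * r_series"

lemma hseries_nth_0 [simp]: "fps_nth (hseries c) 0 = c"
  by (simp add: hseries_def)

lemma hseries_nth_pos:
  assumes "k > 0"
  shows "fps_nth (hseries c) k = of_bool (\<exists>q. k = 2 ^ q)"
proof -
  \<comment> \<open>Positivity of \<open>k\<close> matters here: subtraction is truncated, so
    \<open>k = 0\<close>, \<open>q = 0\<close> would satisfy only the left side.\<close>
  have "k - 1 = 2 ^ q - 1 \<longleftrightarrow> k = 2 ^ q" for q :: nat
    using assms one_le_power[of "2::nat" q] by linarith
  then show ?thesis
    using assms by (simp add: hseries_def r_series_nth)
qed

lemma hseries_nth_power: "fps_nth (hseries c) (2 ^ q) = 1"
  by (auto simp: hseries_nth_pos)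

lemma hseries_nth_between:
  assumes "2 ^ q < k" "k < 2 ^ Suc q"
  shows "fps_nth (hseries c) k = 0"
proof -
  have "k \<noteq> 2 ^ q'" for q'
  proof
    assume "k = 2 ^ q'"
    with assms have "(2::nat) ^ q < 2 ^ q'" "(2::nat) ^ q' < 2 ^ Suc q" by simp_all
    then have "q < q'" "q' < Suc q" by (simp_all only: power_strict_increasing_iff one_less_numeral_iff semiring_norm)
    then show False by simp
  qed
  moreover have "k > 0" using assms(1) by simp
  ultimately show ?thesis by (simp add: hseries_nth_pos)
qed

section \<open>Reduction of the Hankel determinant\<close>

lemma hankel_det_hseries_step:
  fixes k n :: nat
  assumes hn: "2 ^ k \<le> n" and nh: "n < 2 ^ Suc k"
  defines "m \<equiv> 2 ^ Suc k - 1 - n"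
  shows "\<bar>hankel_det (Suc n) (hseries c)\<bar> = \<bar>hankel_det (Suc m) (hseries (c - 1))\<bar>"
proof -
  define h :: nat where "h = 2 ^ k"
  define a where "a = fps_nth (hseries c)"
  have h: "h \<le> n" "n < 2 * h" and m: "m + n + 1 = 2 * h" "m < h"
    using hn nh unfolding h_def m_def by (simp_all)
  have a_h [simp]: "a h = 1" and a_2h [simp]: "a (2 * h) = 1"
    unfolding a_def h_def using hseries_nth_power[of c k] hseries_nth_power[of c "Suc k"] by simp_all
  have a1: "a x = 0" if "h < x" "x < 2 * h" for x
    unfolding a_def by (rule hseries_nth_between[of k]) (use that in \<open>simp_all add: h_def\<close>)
  have a2: "a x = 0" if "2 * h < x" "x < 4 * h" for x
    unfolding a_def by (rule hseries_nth_between[of "Suc k"]) (use that in \<open>simp_all add: h_def\<close>)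
  let ?q = "n - m"
  define M where "M = mat (Suc n) (Suc n) (\<lambda>(i, j). a (i + j))"
  \<comment> \<open>The indices \<open>m + 1, ..., n\<close> are reflected about \<open>h\<close>,
    because \<open>m + 1 + n = 2 * h\<close>. As a row permutation this carries the ones with
    \<open>i + j = 2 * h\<close> to the diagonal of \<open>D\<close>.\<close>
  define \<pi> where "\<pi> i = (if m < i \<and> i \<le> n then 2 * h - i else i)" for i
  have perm: "\<pi> permutes {0..<Suc n}"
  proof (rule bij_imp_permutes)
    show "bij_betw \<pi> {0..<Suc n} {0..<Suc n}"
      by (rule bij_betw_byWitness[of _ \<pi>]) (use m in \<open>auto simp: \<pi>_def\<close>)
  qed (auto simp: \<pi>_def)
  define A where "A = mat (Suc m) (Suc m) (\<lambda>(i, j). a (i + j))"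
  define B where "B = mat (Suc m) ?q (\<lambda>(i, l). a (i + (Suc m + l)))"
  define C where "C = mat ?q (Suc m) (\<lambda>(l, j). a (2 * h - (Suc m + l) + j))"
  define D where "D = mat ?q ?q (\<lambda>(l, j). a (2 * h - (Suc m + l) + (Suc m + j)))"
  have A: "A \<in> carrier_mat (Suc m) (Suc m)" and B: "B \<in> carrier_mat (Suc m) ?q"
    and C: "C \<in> carrier_mat ?q (Suc m)" and D: "D \<in> carrier_mat ?q ?q"
    unfolding A_def B_def C_def D_def by simp_all
  \<comment> \<open>The argument of \<open>a\<close> exceeds \<open>h\<close> and is at most
    \<open>m + n = 2 * h - 1\<close>.\<close>
  have B0: "B $$ (i, l) = 0" if "i < Suc m" "l < ?q" "h < Suc m + l" for i l
    using that m h by (auto simp: B_def intro!: a1)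
  have blocks: "mat (Suc n) (Suc n) (\<lambda>(i, j). M $$ (\<pi> i, j)) = four_block_mat A B C D"
  proof (rule eq_matI)
    fix i j
    assume "i < dim_row (four_block_mat A B C D)" "j < dim_col (four_block_mat A B C D)"
    then have ij: "i < Suc n" "j < Suc n" using h m A D by auto
    moreover have "\<pi> i < Suc n" using permutes_in_image[OF perm, of i] ij by simp
    ultimately show "mat (Suc n) (Suc n) (\<lambda>(i, j). M $$ (\<pi> i, j)) $$ (i, j) =
        four_block_mat A B C D $$ (i, j)"
      using h m by (auto simp: M_def \<pi>_def A_def B_def C_def D_def Suc_diff_Suc intro!: arg_cong[of _ _ a])
  qed (use h m in \<open>simp_all add: A_def D_def\<close>)
  \<comment> \<open>By \<open>B0\<close> only those \<open>l\<close> with \<open>Suc m + l\<close>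
    \<le> \<open>h\<close> contribute. For them row \<open>l\<close> of \<open>D\<close> is a unit
    vector: its entries are \<open>a (2 * h + j - l)\<close>, and \<open>l < h\<close> keeps the
    argument strictly between \<open>h\<close> and \<open>4 * h\<close>, where \<open>a\<close>
    vanishes except at \<open>2 * h\<close>.\<close>
  have BD: "B * D = B"
  proof (rule eq_matI)
    fix i j assume "i < dim_row B" "j < dim_col B"
    then have ij: "i < Suc m" "j < ?q" using B by auto
    have "(B * D) $$ (i, j) = (\<Sum>l\<in>{0..<?q}. B $$ (i, l) * D $$ (l, j))"
      using ij B D by (simp add: scalar_prod_def)
    also have "\<dots> = (\<Sum>l\<in>{0..<?q}. if l = j then B $$ (i, j) else 0)"
    proof (rule sum.cong[OF refl])
      fix l assume "l \<in> {0..<?q}"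
      then have l: "l < ?q" by simp
      show "B $$ (i, l) * D $$ (l, j) = (if l = j then B $$ (i, j) else 0)"
      proof (cases "h < Suc m + l")
        case True
        then show ?thesis using B0[OF ij(1) l] by auto
      next
        case False
        consider "l = j" | "l < j" | "j < l" by linarith
        then have "D $$ (l, j) = of_bool (l = j)"
        proof cases
          case 1
          then show ?thesis using l ij m False by (simp add: D_def)
        next
          case 2
          then show ?thesis using l ij m h False by (auto simp: D_def intro!: a2)
        next
          case 3
          then show ?thesis using l ij m h False by (auto simp: D_def intro!: a1)
        qed
        then show ?thesis by simp
      qed
    qed
    finally show "(B * D) $$ (i, j) = B $$ (i, j)" using ij by simp
  qed (use B D in auto)
  have ABC: "A - B * C = mat (Suc m) (Suc m) (\<lambda>(i, j). fps_nth (hseries (c - 1)) (i + j))"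
  proof (rule eq_matI, goal_cases)
    case (1 i j)
    then have ij: "i < Suc m" "j < Suc m" by auto
    have "(B * C) $$ (i, j) = (\<Sum>l\<in>{0..<?q}. B $$ (i, l) * C $$ (l, j))"
      using ij B C by (simp add: scalar_prod_def)
    \<comment> \<open>\<open>h - Suc m\<close> is the position of the index \<open>h\<close> within
      the block. There the column of \<open>B\<close> and the row of \<open>C\<close> each have a
      single 1, at position 0; for every other \<open>l\<close> one factor vanishes. So
      \<open>B * C\<close> only lowers the corner entry \<open>c\<close> by 1.\<close>
    also have "\<dots> = (\<Sum>l\<in>{0..<?q}. if l = h - Suc m then of_bool (i + j = 0) else 0)"
    proof (rule sum.cong[OF refl])
      fix l assume "l \<in> {0..<?q}"
      then have l: "l < ?q" by simp
      consider "h < Suc m + l" | "Suc m + l < h" | "Suc m + l = h" by linarith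
      then show "B $$ (i, l) * C $$ (l, j) = (if l = h - Suc m then of_bool (i + j = 0) else 0)"
      proof cases
        case 1
        then show ?thesis using B0[OF ij(1) l] m by auto
      next
        case 2
        then have "C $$ (l, j) = 0" using ij l m h by (auto simp: C_def intro!: a1)
        then show ?thesis using 2 by auto
      next
        case 3
        have "B $$ (i, l) = a (i + (Suc m + l))"
          using l ij by (simp add: B_def)
        also have "i + (Suc m + l) = h + i" using 3 by simp
        also have "a (h + i) = of_bool (i = 0)"
          using ij m by (cases "i = 0") (auto intro!: a1)
        finally have Bi: "B $$ (i, l) = of_bool (i = 0)" .
        have "C $$ (l, j) = a (2 * h - (Suc m + l) + j)"
          using l ij by (simp add: C_def)
        also have "2 * h - (Suc m + l) + j = h + j" using 3 by simp
        also have "a (h + j) = of_bool (j = 0)"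
          using ij m by (cases "j = 0") (auto intro!: a1)
        finally have "C $$ (l, j) = of_bool (j = 0)" .
        with Bi show ?thesis using 3 by auto
      qed
    qed
    also have "\<dots> = of_bool (i + j = 0)" using h m by simp
    finally show ?case
      using ij B C by (auto simp: A_def a_def hseries_nth_pos)
  qed (use B C in auto)
  \<comment> \<open>Above the diagonal the argument of \<open>a\<close> lies strictly between
    \<open>2 * h\<close> and \<open>4 * h\<close>; on it the argument is
    \<open>2 * h\<close>.\<close>
  have "det D = prod_list (diag_mat D)"
    by (rule det_lower_triangular[OF _ D]) (use h m in \<open>auto simp: D_def intro!: a2\<close>)
  also have "\<dots> = (\<Prod>i = 0..<?q. 1)"
    unfolding prod_list_diag_prod using D m by (intro prod.cong) (auto simp: D_def)
  finally have detD: "det D = 1" by simp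
  have "signof \<pi> * det M = det (four_block_mat A B C D)"
    unfolding blocks[symmetric] by (rule det_permute_rows[symmetric, OF _ perm]) (simp add: M_def)
  also have "\<dots> = hankel_det (Suc m) (hseries (c - 1))"
    using det_four_block_mat_absorb[OF A B C D BD] detD ABC by (simp add: hankel_det_def)
  finally have "signof \<pi> * hankel_det (Suc n) (hseries c) = hankel_det (Suc m) (hseries (c - 1))"
    by (simp add: hankel_det_def M_def a_def)
  then show ?thesis
    by (metis abs_mult abs_1 abs_minus_cancel mult_1 sign_cases of_int_1 of_int_minus)
qed

section \<open>Partial sums of \<open>j_seq\<close>\<close>

definition j_sum :: "nat \<Rightarrow> int" where
  "j_sum n = (\<Sum>k = 0..n. j_seq k)"

lemma j_sum_0 [simp]: "j_sum 0 = 0"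
  by (simp add: j_sum_def j_seq_recurrence)

lemma j_sum_Suc [simp]: "j_sum (Suc n) = j_sum n + j_seq (Suc n)"
  by (simp add: j_sum_def)

text \<open>The even indices reproduce \<open>j_sum n\<close>. The odd ones contribute 1, -1, 1,
  ..., with \<open>n\<close> or \<open>n + 1\<close> terms, which sum to 1 exactly when their number
  is odd.\<close>

lemma j_sum_double:
  "j_sum (2 * n) = j_sum n + of_bool (odd n)"
  "j_sum (2 * n + 1) = j_sum n + of_bool (even n)"
proof -
  have odd: "j_seq (Suc (2 * k)) = (- 1) ^ k" for k
    using j_seq_recurrence(3)[of k] by simp
  have "j_sum (2 * n) = j_sum n + of_bool (odd n) \<and>
    j_sum (2 * n + 1) = j_sum n + of_bool (even n)"
  proof (induction n)
    case (Suc n)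
    have "j_seq (Suc (Suc (2 * n))) = j_seq (Suc n)"
      using j_seq_recurrence(2)[of "Suc n"] by simp
    then show ?case
      using Suc odd[of n] odd[of "Suc n"] by auto
  qed (use odd[of 0] in simp)
  then show "j_sum (2 * n) = j_sum n + of_bool (odd n)"
    "j_sum (2 * n + 1) = j_sum n + of_bool (even n)" by simp_all
qed

text \<open>The two arguments are bitwise complements with \<open>Suc k\<close> bits, and halving
  preserves this. Complements have opposite parity, so both sides receive the same correction from
  \<open>j_sum_double\<close>.\<close>

lemma j_sum_reflect:
  assumes "2 ^ k \<le> n" "n < 2 ^ Suc k"
  shows "j_sum n = 1 + j_sum (2 ^ Suc k - 1 - n)"
  using assms
proof (induction k arbitrary: n)
  case 0
  then have "n = 2 * 0 + 1" by simp
  then show ?case using j_sum_double(2)[of 0] by simp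
next
  case (Suc k)
  let ?r = "2 ^ Suc k - 1 - n div 2"
  have half: "2 ^ k \<le> n div 2" "n div 2 < 2 ^ Suc k"
    using Suc.prems by auto
  have par: "odd ?r \<longleftrightarrow> even (n div 2)"
    using half(2) by (simp add: even_diff_nat)
  have IH: "j_sum (n div 2) = 1 + j_sum ?r" by (rule Suc.IH[OF half])
  show ?case
  proof (cases "even n")
    case True
    then obtain t where t: "n = 2 * t" by (elim evenE)
    have "2 ^ Suc (Suc k) - 1 - n = 2 * ?r + 1" using half t by simp
    then show ?thesis using IH par t by (simp only: j_sum_double) (auto simp del: even_diff_nat)
  next
    case False
    then obtain t where t: "n = 2 * t + 1" by (elim oddE)
    have "2 ^ Suc (Suc k) - 1 - n = 2 * ?r" using half t by simp
    then show ?thesis using IH par t by (simp only: j_sum_double) (auto simp del: even_diff_nat)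
  qed
qed

lemma j_sum_nonneg: "j_sum n \<ge> 0"
proof (induction n rule: less_induct)
  case (less n)
  show ?case
  proof (cases "n = 0")
    case False
    then have "j_sum (n div 2) \<ge> 0" by (intro less.IH) simp
    moreover have "n = 2 * (n div 2) \<or> n = 2 * (n div 2) + 1" by presburger
    ultimately show ?thesis
      using j_sum_double[of "n div 2"] by (auto simp del: j_sum_Suc)
  qed simp
qed

lemma dyadic_interval:
  fixes n :: nat
  assumes "n > 0"
  obtains k where "2 ^ k \<le> n" "n < 2 ^ Suc k"
  using ex_power_ivl1[of 2 n] assms by auto

text \<open>Reflection writes the sum as 1 plus a nonnegative one. This settles the sign of
  \<open>1 - j_sum n\<close> in the final evaluation.\<close>

lemma j_sum_pos:
  assumes "n > 0"
  shows "j_sum n \<ge> 1"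
  using dyadic_interval[OF assms] j_sum_reflect j_sum_nonneg by (metis le_add_same_cancel1)

section \<open>Evaluation of the determinant\<close>

text \<open>The constant \<open>c\<close> stays general in the induction: passing from
  \<open>n\<close> to its reflection lowers both \<open>c\<close> and the partial sum by 1, down to
  the 1 by 1 determinant \<open>c\<close>.\<close>

lemma abs_hankel_det_hseries: "\<bar>hankel_det (Suc n) (hseries c)\<bar> = \<bar>c - j_sum n\<bar>"
proof (induction n arbitrary: c rule: less_induct)
  case (less n)
  show ?case
  proof (cases "n = 0")
    case True
    then show ?thesis by (simp add: hankel_det_def det_single)
  next
    case False
    then obtain k where k: "2 ^ k \<le> n" "n < 2 ^ Suc k" using dyadic_interval by blast
    let ?m = "2 ^ Suc k - 1 - n"
    have "?m < n" using k False by simp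
    then show ?thesis
      using hankel_det_hseries_step[OF k, of c] less.IH[of ?m "c - 1"] j_sum_reflect[OF k]
      by (simp add: algebra_simps)
  qed
qed

theorem theorem32:
  fixes n :: nat
  assumes "n \<ge> 1"
  shows "\<bar>hankel_det (n + 1) (1 + fps_X * r_series)\<bar> = s_seq n - 2"
  \<comment> \<open>The series is the case \<open>c = 1\<close>, and
    \<open>s_seq n = 1 + j_sum n\<close>.\<close>
  using abs_hankel_det_hseries[of n 1] j_sum_pos[of n] assms
  by (simp add: hseries_def s_seq_def j_sum_def)

end
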